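(* Given correct adaptive weight predictions, there exists a non-clairvoyant $4$-competitive algorithm for minimizing the total weighted completion time of jobs with online out-forest precedence constraints on a single machine.
   Context: Problem (non-clairvoyant single-machine scheduling with online precedence constraints): jobs $J$ with processing requirements $p_j\ge0$ and weights $w_j\ge0$; precedence DAG $G=(J,E)$ which is an out-forest (every job has at most one incoming edge). A job can only be processed after all its predecessors are completed, and is revealed to the algorithm (with its weight but not its processing requirement) only then; the algorithm does not know $G$. Time is discrete; rates $R_j^t\ge0$ with $\sum_jR_j^t\le1$; $C_j$ is the first $t$ with $\sum_{t'\le t}R_j^{t'}\ge p_j$. Objective: minimize $\sum_jw_jC_j$ against the offline optimum; $\rho$-competitive means $\mathrm{Alg}\le\rho\,\mathrm{Opt}$ always. For a job $v$, $S(v)$ is $v$ together with all its successors and $w(S(v))=\sum_{u\in S(v)}w_u$. Adaptive weight predictions: whenever a job $v$ becomes visible, the algorithm receives a prediction $\hat W_v$ of $w(S(v))$; correct means $\hat W_v=w(S(v))$. *)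

theory Defs
  imports Complex_Main
begin

record 'a sched_instance =
  jobs :: "'a set"
  edges :: "('a \<times> 'a) set"
  proc :: "'a \<Rightarrow> real"
  weight :: "'a \<Rightarrow> real"

definition preds :: "'a sched_instance \<Rightarrow> 'a \<Rightarrow> 'a set" where
  "preds I j = {i. (i, j) \<in> (edges I)\<^sup>+}"

definition succ_closed :: "'a sched_instance \<Rightarrow> 'a \<Rightarrow> 'a set" where
  "succ_closed I v = {u. (v, u) \<in> (edges I)\<^sup>*}"

definition out_forest_instance :: "'a sched_instance \<Rightarrow> bool" where
  "out_forest_instance I \<longleftrightarrow>
     finite (jobs I) \<and> edges I \<subseteq> jobs I \<times> jobs I \<and> acyclic (edges I) \<and>
     (\<forall>i i' j. (i, j) \<in> edges I \<and> (i', j) \<in> edges I \<longrightarrow> i = i') \<and>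
     (\<forall>j\<in>jobs I. 0 \<le> proc I j \<and> 0 \<le> weight I j)"

text \<open>A schedule \<open>R\<close> assigns to time step \<open>t\<close> and job \<open>j\<close> the rate \<open>R t j\<close>. Time steps are
  \<open>1, 2, \<dots>\<close>; the value \<open>R 0\<close> is never used.\<close>

type_synonym 'a schedule = "nat \<Rightarrow> 'a \<Rightarrow> real"

text \<open>The jobs completed by the end of step \<open>t\<close>. Requiring the predecessors to be completed in an
  earlier step matters only for jobs of size 0, which would otherwise count as completed before they
  can be started; see \<open>completion_time_eq\<close> below.\<close>

primrec completed :: "'a sched_instance \<Rightarrow> 'a schedule \<Rightarrow> nat \<Rightarrow> 'a set" where
  "completed I R 0 = {}"
| "completed I R (Suc t) =
     {j \<in> jobs I. preds I j \<subseteq> completed I R t \<and> proc I j \<le> (\<Sum>s=1..Suc t. R s j)}"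

definition completion_time :: "'a sched_instance \<Rightarrow> 'a schedule \<Rightarrow> 'a \<Rightarrow> nat" where
  "completion_time I R j = (LEAST t. j \<in> completed I R t)"

definition feasible :: "'a sched_instance \<Rightarrow> 'a schedule \<Rightarrow> bool" where
  "feasible I R \<longleftrightarrow>
     (\<forall>t\<ge>1. (\<forall>j. 0 \<le> R t j) \<and> (\<Sum>j\<in>jobs I. R t j) \<le> 1 \<and>
        (\<forall>j. 0 < R t j \<longrightarrow> j \<in> jobs I \<and> preds I j \<subseteq> completed I R (t - 1))) \<and>
     (\<forall>j\<in>jobs I. \<exists>t. j \<in> completed I R t)"

definition cost :: "'a sched_instance \<Rightarrow> 'a schedule \<Rightarrow> real" where
  "cost I R = (\<Sum>j\<in>jobs I. weight I j * real (completion_time I R j))"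

definition Opt :: "'a sched_instance \<Rightarrow> real" where
  "Opt I = Inf (cost I ` {R. feasible I R})"

definition front :: "'a sched_instance \<Rightarrow> 'a schedule \<Rightarrow> nat \<Rightarrow> 'a set" where
  "front I R t =
     {j \<in> jobs I. j \<notin> completed I R (t - 1) \<and> preds I j \<subseteq> completed I R (t - 1)}"

text \<open>What an algorithm sees at the start of a step: the currently visible jobs, each with its
  weight and its predicted value. A non-clairvoyant algorithm chooses the rates of step \<open>t\<close> from the
  observations made in the steps \<open>1, \<dots>, t\<close> alone.\<close>

type_synonym 'a observation = "'a \<Rightarrow> (real \<times> real) option"
type_synonym 'a online_algorithm = "'a observation list \<Rightarrow> 'a \<Rightarrow> real"

definition observe ::
  "'a sched_instance \<Rightarrow> ('a \<Rightarrow> real) \<Rightarrow> 'a schedule \<Rightarrow> nat \<Rightarrow> 'a observation" where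
  "observe I What R t = (\<lambda>j. if j \<in> front I R t then Some (weight I j, What j) else None)"

primrec run ::
  "'a online_algorithm \<Rightarrow> 'a sched_instance \<Rightarrow> ('a \<Rightarrow> real) \<Rightarrow> nat \<Rightarrow> 'a schedule" where
  "run A I What 0 = (\<lambda>t j. 0)"
| "run A I What (Suc n) =
     (run A I What n)(Suc n := A (map (observe I What (run A I What n)) [1..<Suc (Suc n)]))"

definition alg_schedule ::
  "'a online_algorithm \<Rightarrow> 'a sched_instance \<Rightarrow> ('a \<Rightarrow> real) \<Rightarrow> 'a schedule" where
  "alg_schedule A I What t = run A I What t t"

definition correct_predictions :: "'a sched_instance \<Rightarrow> ('a \<Rightarrow> real) \<Rightarrow> bool" where
  "correct_predictions I What \<longleftrightarrow> (\<forall>v\<in>jobs I. What v = (\<Sum>u\<in>succ_closed I v. weight I u))"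

lemma completed_cong:
  "(\<And>s. 1 \<le> s \<Longrightarrow> s \<le> t \<Longrightarrow> R s = R' s) \<Longrightarrow> completed I R t = completed I R' t"
proof (induction t)
  case (Suc t)
  have "(\<Sum>s=1..Suc t. R s j) = (\<Sum>s=1..Suc t. R' s j)" for j
    using Suc.prems by (intro sum.cong) auto
  moreover have "completed I R t = completed I R' t"
    using Suc by simp
  ultimately show ?case by simp
qed simp

lemma run_eq: "s \<le> n \<Longrightarrow> run A I What n s = alg_schedule A I What s"
  by (induction n) (auto simp: alg_schedule_def le_Suc_eq)

theorem alg_schedule_step:
  assumes "1 \<le> t"
  shows "alg_schedule A I What t =
    A (map (observe I What (alg_schedule A I What)) [1..<Suc t])"
proof -
  obtain n where t: "t = Suc n"
    using assms by (cases t) auto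
  have "completed I (run A I What n) (s - 1) = completed I (alg_schedule A I What) (s - 1)"
    if "s \<le> Suc n" for s
    using that by (intro completed_cong run_eq) auto
  then have "observe I What (run A I What n) s = observe I What (alg_schedule A I What) s"
    if "s \<le> Suc n" for s
    using that by (simp add: observe_def front_def)
  then have *: "map (observe I What (run A I What n)) [1..<Suc (Suc n)] =
      map (observe I What (alg_schedule A I What)) [1..<Suc (Suc n)]"
    by (intro map_cong) auto
  have "alg_schedule A I What t = A (map (observe I What (run A I What n)) [1..<Suc (Suc n)])"
    by (simp only: t alg_schedule_def run.simps fun_upd_same)
  also note *
  finally show ?thesis by (simp only: t)
qed

lemma completed_Suc_mono:
  assumes "feasible I R"
  shows "completed I R t \<subseteq> completed I R (Suc t)"
proof (induction t)
  case (Suc t)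
  have "(\<Sum>s=1..Suc t. R s j) \<le> (\<Sum>s=1..Suc (Suc t). R s j)" for j
    using assms by (simp add: feasible_def)
  with Suc show ?case
    unfolding completed.simps(2) by (blast intro: order_trans)
qed simp

theorem completion_time_eq:
  assumes "feasible I R" "j \<in> jobs I" "0 < proc I j"
  shows "completion_time I R j = (LEAST t. proc I j \<le> (\<Sum>s=1..t. R s j))"
proof -
  have "j \<in> completed I R t \<longleftrightarrow> proc I j \<le> (\<Sum>s=1..t. R s j)" for t
  proof
    assume "j \<in> completed I R t"
    then show "proc I j \<le> (\<Sum>s=1..t. R s j)" by (cases t) auto
  next
    assume *: "proc I j \<le> (\<Sum>s=1..t. R s j)"
    then have "0 < (\<Sum>s=1..t. R s j)" using assms by simp
    then obtain s where s: "s \<in> {1..t}" "0 < R s j"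
      using sum_nonpos[of "{1..t}" "\<lambda>s. R s j"] by (force simp: not_le)
    then have "preds I j \<subseteq> completed I R (s - 1)"
      using assms(1) by (auto simp: feasible_def)
    also have "\<dots> \<subseteq> completed I R (t - 1)"
      using s by (intro lift_Suc_mono_le[of "completed I R", OF completed_Suc_mono[OF assms(1)]]) auto
    finally have "preds I j \<subseteq> completed I R (t - 1)" .
    with * s assms(2) show "j \<in> completed I R t" by (cases t) auto
  qed
  then show ?thesis by (simp add: completion_time_def)
qed

definition competitive_given_correct_predictions :: "real \<Rightarrow> 'a online_algorithm \<Rightarrow> bool" where
  "competitive_given_correct_predictions \<rho> A \<longleftrightarrow>
     (\<forall>I What. out_forest_instance I \<and> correct_predictions I What \<longrightarrow>
        feasible I (alg_schedule A I What) \<and>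
        cost I (alg_schedule A I What) \<le> \<rho> * Opt I)"

end

theory Submission imports Defs begin

text \<open>The algorithm runs every front job \<open>j\<close> at rate \<open>w(S(j)) / W\<close>, where \<open>W\<close> is the total
  unfinished weight; in an out-forest \<open>W\<close> is the sum of \<open>w(S(j))\<close> over the front.

  Fix a feasible schedule with completion times \<open>c\<close>. In each step, the front jobs \<open>j\<close> with
  \<open>c j \<le> c u\<close> carry at least the unfinished weight of all jobs \<open>k\<close> with \<open>c k \<le> c u\<close>, so the
  \<open>w\<close>-weighted sum over unfinished \<open>u\<close> of the total rate of those \<open>j\<close> is at least
  \<open>(1/W) \<Sum> {w\<^sub>u w\<^sub>k | c k \<le> c u} \<ge> W/2\<close>. Summed over all steps, the left side splits in two.
  Rate spent on jobs that do not finish in the current step amounts to at most \<open>p\<^sub>j\<close> per job, and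
  the jobs with \<open>c j \<le> c u\<close> have total size at most \<open>c u\<close>; this part is at most \<open>\<Sum> w\<^sub>u c u\<close>.
  The steps in which a job finishes contribute at most \<open>\<Sum> w(S(j)) = \<Sum> w\<^sub>u depth(u)\<close>, again at
  most \<open>\<Sum> w\<^sub>u c u\<close>, as the jobs on a chain finish in distinct steps. Since the algorithm
  pays \<open>\<Sum> W\<close>, it pays at most \<open>4 \<Sum> w\<^sub>u c u\<close>.\<close>

section \<open>Ordered pairs, and completion in arbitrary schedules\<close>

text \<open>Any two elements satisfy \<open>c k \<le> c u\<close> or \<open>c u \<le> c k\<close>,
  so each product \<open>w u * w k\<close> is counted by at least one of the two orders; swapping
  the sums identifies both totals.\<close>

lemma sum_square_le_twice_ordered:
  fixes w :: "'a \<Rightarrow> real" and c :: "'a \<Rightarrow> 'b::linorder"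
  assumes fin: "finite U" and w: "\<And>u. u \<in> U \<Longrightarrow> 0 \<le> w u"
  shows "(\<Sum>u\<in>U. w u)\<^sup>2 \<le> 2 * (\<Sum>u\<in>U. w u * (\<Sum>k\<in>{k \<in> U. c k \<le> c u}. w k))"
proof -
  let ?g = "\<lambda>u k. if c k \<le> c u then w u * w k else 0"
  have eq: "(\<Sum>u\<in>U. w u * (\<Sum>k\<in>{k \<in> U. c k \<le> c u}. w k)) = (\<Sum>u\<in>U. \<Sum>k\<in>U. ?g u k)"
    using fin by (auto simp: sum_distrib_left sum.inter_filter intro!: sum.cong)
  have "(\<Sum>u\<in>U. w u)\<^sup>2 = (\<Sum>u\<in>U. \<Sum>k\<in>U. w u * w k)"
    by (simp add: power2_eq_square sum_product)
  also have "\<dots> \<le> (\<Sum>u\<in>U. \<Sum>k\<in>U. ?g u k + ?g k u)"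
    using w by (intro sum_mono) (auto simp: mult.commute)
  also have "\<dots> = (\<Sum>u\<in>U. \<Sum>k\<in>U. ?g u k) + (\<Sum>u\<in>U. \<Sum>k\<in>U. ?g k u)"
    by (simp add: sum.distrib)
  also have "(\<Sum>u\<in>U. \<Sum>k\<in>U. ?g k u) = (\<Sum>u\<in>U. \<Sum>k\<in>U. ?g u k)"
    by (rule sum.swap)
  finally show ?thesis by (simp add: eq)
qed

text \<open>Stated for nonnegative rates, since the algorithm's schedule needs monotonicity before
  its feasibility is established.\<close>

lemma completed_mono:
  assumes nonneg: "\<And>t j. 1 \<le> t \<Longrightarrow> 0 \<le> R t j" and "s \<le> t"
  shows "completed I R s \<subseteq> completed I R t"
proof -
  have "completed I R n \<subseteq> completed I R (Suc n)" for n
  proof (induction n)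
    case (Suc n)
    have "(\<Sum>s=1..Suc n. R s j) \<le> (\<Sum>s=1..Suc (Suc n). R s j)" for j
      using nonneg by simp
    with Suc show ?case
      unfolding completed.simps(2) by (blast intro: order_trans)
  qed simp
  then show ?thesis
    using \<open>s \<le> t\<close> by (rule lift_Suc_mono_le)
qed

lemma completed_subset_jobs: "completed I R t \<subseteq> jobs I"
  by (cases t) auto

lemma preds_of_completed: "u \<in> completed I R t \<Longrightarrow> preds I u \<subseteq> completed I R (t - 1)"
  by (cases t) auto

lemma completed_iff_completion_time_le:
  assumes nonneg: "\<And>t j. 1 \<le> t \<Longrightarrow> 0 \<le> R t j" and fin: "\<exists>t. j \<in> completed I R t"
  shows "j \<in> completed I R t \<longleftrightarrow> completion_time I R j \<le> t"
proof
  assume "j \<in> completed I R t"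
  then show "completion_time I R j \<le> t"
    unfolding completion_time_def by (rule Least_le)
next
  assume "completion_time I R j \<le> t"
  moreover have "j \<in> completed I R (completion_time I R j)"
    unfolding completion_time_def using fin by (rule LeastI_ex)
  ultimately show "j \<in> completed I R t"
    using completed_mono[of R, OF nonneg] by blast
qed

text \<open>Each job of \<open>K\<close> has received at least its size by step \<open>t\<close>,
  and every step hands out at most one unit of rate.\<close>

lemma volume_le_time:
  assumes "feasible I Q" "finite (jobs I)" "K \<subseteq> completed I Q t"
  shows "(\<Sum>j\<in>K. proc I j) \<le> real t"
proof -
  have KJ: "K \<subseteq> jobs I"
    using assms(3) completed_subset_jobs[of I Q t] by (rule order_trans)
  have "(\<Sum>j\<in>K. proc I j) \<le> (\<Sum>j\<in>K. \<Sum>s=1..t. Q s j)"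
  proof (rule sum_mono)
    fix j assume "j \<in> K"
    with assms(3) have "j \<in> completed I Q t" by blast
    then show "proc I j \<le> (\<Sum>s=1..t. Q s j)" by (cases t) auto
  qed
  also have "\<dots> \<le> (\<Sum>j\<in>jobs I. \<Sum>s=1..t. Q s j)"
    using assms KJ by (intro sum_mono2 sum_nonneg) (auto simp: feasible_def)
  also have "\<dots> = (\<Sum>s=1..t. \<Sum>j\<in>jobs I. Q s j)"
    by (rule sum.swap)
  also have "\<dots> \<le> (\<Sum>s=1..t. 1)"
    using assms(1) by (intro sum_mono) (auto simp: feasible_def)
  finally show ?thesis by simp
qed

section \<open>Out-forests and subtree weights\<close>

definition subtree_weight :: "'a sched_instance \<Rightarrow> 'a \<Rightarrow> real" where
  "subtree_weight I v = (\<Sum>u\<in>succ_closed I v. weight I u)"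

locale out_forest =
  fixes I :: "'a sched_instance"
  assumes out_forest: "out_forest_instance I"
begin

lemma finite_jobs: "finite (jobs I)"
  and edges_subset: "edges I \<subseteq> jobs I \<times> jobs I"
  and acyclic_edges: "acyclic (edges I)"
  and parent_unique: "(i, j) \<in> edges I \<Longrightarrow> (i', j) \<in> edges I \<Longrightarrow> i = i'"
  and proc_nonneg: "j \<in> jobs I \<Longrightarrow> 0 \<le> proc I j"
  and weight_nonneg: "j \<in> jobs I \<Longrightarrow> 0 \<le> weight I j"
  using out_forest by (auto simp: out_forest_instance_def)

lemma edge_rtrancl_jobs: "(v, u) \<in> (edges I)\<^sup>* \<Longrightarrow> v \<in> jobs I \<Longrightarrow> u \<in> jobs I"
  by (induction rule: rtrancl_induct) (use edges_subset in auto)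

lemma succ_closed_subset_jobs: "v \<in> jobs I \<Longrightarrow> succ_closed I v \<subseteq> jobs I"
  using edge_rtrancl_jobs by (auto simp: succ_closed_def)

lemma finite_succ_closed: "v \<in> jobs I \<Longrightarrow> finite (succ_closed I v)"
  using succ_closed_subset_jobs finite_jobs finite_subset by blast

lemma preds_subset_jobs: "preds I j \<subseteq> jobs I"
  using trancl_subset_Sigma[OF edges_subset] by (auto simp: preds_def)

lemma mem_succ_closed_iff: "u \<in> succ_closed I v \<longleftrightarrow> u = v \<or> v \<in> preds I u"
  by (auto simp: succ_closed_def preds_def rtrancl_eq_or_trancl)

lemma subtree_weight_nonneg: "v \<in> jobs I \<Longrightarrow> 0 \<le> subtree_weight I v"
  unfolding subtree_weight_def
  using succ_closed_subset_jobs weight_nonneg by (blast intro: sum_nonneg)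

text \<open>Every job has at most one parent, so the reversed edges are single-valued: the way up
  from \<open>u\<close> is one path, which carries both \<open>i\<close> and
  \<open>j\<close>.\<close>

lemma ancestors_comparable:
  assumes "(i, u) \<in> (edges I)\<^sup>*" "(j, u) \<in> (edges I)\<^sup>*"
  shows "(i, j) \<in> (edges I)\<^sup>* \<or> (j, i) \<in> (edges I)\<^sup>*"
proof -
  have "single_valued ((edges I)\<inverse>)"
    using parent_unique by (auto simp: single_valued_def)
  moreover have "(u, i) \<in> ((edges I)\<inverse>)\<^sup>*" "(u, j) \<in> ((edges I)\<inverse>)\<^sup>*"
    using assms by (simp_all add: rtrancl_converse)
  ultimately have "(i, j) \<in> ((edges I)\<inverse>)\<^sup>* \<or> (j, i) \<in> ((edges I)\<inverse>)\<^sup>*"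
    by (rule single_valued_confluent)
  then show ?thesis by (auto simp: rtrancl_converse)
qed

text \<open>Predecessors form a chain whose jobs finish in distinct steps. This covers jobs of size
  0 too, because \<open>completed\<close> asks for the predecessors one step earlier.\<close>

lemma card_preds_less_time:
  "u \<in> completed I Q t \<Longrightarrow> card (preds I u) < t"
proof (induction t arbitrary: u)
  case (Suc t)
  show ?case
  proof (cases "preds I u = {}")
    case False
    then obtain i where i: "(i, u) \<in> edges I"
      by (auto simp: preds_def elim: tranclE)
    have eq: "preds I u = insert i (preds I i)"
      using i parent_unique unfolding preds_def
      by (auto elim: tranclE intro: trancl_into_trancl) (metis tranclE)
    have "i \<in> completed I Q t"
      using Suc.prems eq by auto
    from Suc.IH[OF this] have "card (preds I i) < t" .
    moreover have "card (preds I u) \<le> Suc (card (preds I i))"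
      unfolding eq by (rule card_insert_le_m1) auto
    ultimately show ?thesis by simp
  qed simp
qed simp

text \<open>Double counting: the weight of \<open>u\<close> appears once for \<open>u\<close> itself
  and once per predecessor, and these jobs form a chain that needs at least that many steps.\<close>

lemma sum_subtree_weight_le_cost:
  assumes "feasible I Q"
  shows "(\<Sum>j\<in>jobs I. subtree_weight I j) \<le> cost I Q"
proof -
  have "(\<Sum>j\<in>jobs I. subtree_weight I j)
      = (\<Sum>j\<in>jobs I. \<Sum>u\<in>{u \<in> jobs I. u \<in> succ_closed I j}. weight I u)"
    using succ_closed_subset_jobs
    by (intro sum.cong refl) (auto simp: subtree_weight_def intro!: sum.cong)
  also have "\<dots> = (\<Sum>u\<in>jobs I. \<Sum>j\<in>{j \<in> jobs I. u \<in> succ_closed I j}. weight I u)"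
    by (rule sum.swap_restrict[OF finite_jobs finite_jobs])
  also have "\<dots> \<le> (\<Sum>u\<in>jobs I. weight I u * real (completion_time I Q u))"
  proof (rule sum_mono)
    fix u assume u: "u \<in> jobs I"
    have "u \<in> completed I Q (completion_time I Q u)"
      unfolding completion_time_def
      by (rule LeastI_ex) (use assms u in \<open>auto simp: feasible_def\<close>)
    then have "card (preds I u) < completion_time I Q u"
      by (rule card_preds_less_time)
    moreover have "{j \<in> jobs I. u \<in> succ_closed I j} = insert u (preds I u)"
      unfolding mem_succ_closed_iff
      by (intro set_eqI iffI) (use u preds_subset_jobs in auto)
    moreover have "finite (preds I u)"
      using preds_subset_jobs finite_jobs by (rule finite_subset)
    then have "card (insert u (preds I u)) \<le> Suc (card (preds I u))"
      by (simp add: card_insert_if)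
    ultimately have "card {j \<in> jobs I. u \<in> succ_closed I j} \<le> completion_time I Q u"
      by simp
    then show "(\<Sum>j\<in>{j \<in> jobs I. u \<in> succ_closed I j}. weight I u)
        \<le> weight I u * real (completion_time I Q u)"
      using weight_nonneg[OF u] by (simp add: mult.commute mult_left_mono)
  qed
  finally show ?thesis by (simp add: cost_def)
qed

end

section \<open>The proportional schedule and its front\<close>

text \<open>The analysis rests on the rates alone, apart from the online interface. When no weight
  is left, the unit of rate is split evenly: \<open>feasible\<close> demands that weightless jobs
  finish as well.\<close>

locale proportional_schedule = out_forest +
  fixes R :: "'a schedule"
  assumes rate: "1 \<le> t \<Longrightarrow> R t j =
    (if j \<in> front I R t
     then if (\<Sum>k\<in>front I R t. subtree_weight I k) = 0 then 1 / real (card (front I R t))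
          else subtree_weight I j / (\<Sum>k\<in>front I R t. subtree_weight I k)
     else 0)"
begin

definition unfinished :: "nat \<Rightarrow> 'a set" where
  "unfinished t = jobs I - completed I R (t - 1)"

lemma front_subset_jobs: "front I R t \<subseteq> jobs I"
  by (auto simp: front_def)

lemma finite_front: "finite (front I R t)"
  using front_subset_jobs finite_jobs finite_subset by blast

lemma finite_unfinished: "finite (unfinished t)"
  using finite_jobs by (simp add: unfinished_def)

lemma rate_nonneg: "1 \<le> t \<Longrightarrow> 0 \<le> R t j"
  using front_subset_jobs subtree_weight_nonneg
  by (auto simp: rate intro!: divide_nonneg_nonneg sum_nonneg)

lemmas completed_mono_alg = completed_mono[of R, OF rate_nonneg]

lemma sum_rate_front:
  assumes "1 \<le> t" "front I R t \<noteq> {}"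
  shows "(\<Sum>j\<in>front I R t. R t j) = 1"
proof (cases "(\<Sum>k\<in>front I R t. subtree_weight I k) = 0")
  case True
  then show ?thesis using assms finite_front[of t] by (simp add: rate)
next
  case False
  then show ?thesis using assms(1) by (simp add: rate flip: sum_divide_distrib)
qed

text \<open>Climbing from an unfinished job through unfinished predecessors ends, by
  well-foundedness, at a front job. Conversely, a completed job has only completed predecessors, so
  nothing below a front job is completed.\<close>

lemma unfinished_eq_Union: "unfinished t = (\<Union>j\<in>front I R t. succ_closed I j)"
proof
  show "unfinished t \<subseteq> (\<Union>j\<in>front I R t. succ_closed I j)"
  proof
    fix u assume u: "u \<in> unfinished t"
    have "wf (edges I)"
      using finite_jobs edges_subset acyclic_edges
      by (meson finite_SigmaI finite_acyclic_wf finite_subset)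
    then have "wf ((edges I)\<^sup>+)" by (rule wf_trancl)
    then show "u \<in> (\<Union>j\<in>front I R t. succ_closed I j)" using u
    proof (induction u rule: wf_induct_rule)
      case (less u)
      show ?case
      proof (cases "preds I u \<subseteq> completed I R (t - 1)")
        case True
        with less.prems have "u \<in> front I R t" by (auto simp: front_def unfinished_def)
        then show ?thesis by (auto simp: mem_succ_closed_iff)
      next
        case False
        then obtain i where i: "i \<in> preds I u" "i \<notin> completed I R (t - 1)" by blast
        then have "i \<in> unfinished t" using preds_subset_jobs by (auto simp: unfinished_def)
        with less.IH i obtain j where "j \<in> front I R t" "i \<in> succ_closed I j"
          by (auto simp: preds_def)
        with i show ?thesis
          by (auto simp: succ_closed_def preds_def dest: trancl_into_rtrancl intro: rtrancl_trans)
      qed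
    qed
  qed
next
  show "(\<Union>j\<in>front I R t. succ_closed I j) \<subseteq> unfinished t"
  proof
    fix u assume "u \<in> (\<Union>j\<in>front I R t. succ_closed I j)"
    then obtain j where j: "j \<in> front I R t" "u \<in> succ_closed I j" by blast
    have "u \<notin> completed I R (t - 1)"
    proof
      assume c: "u \<in> completed I R (t - 1)"
      then have "preds I u \<subseteq> completed I R (t - 1)"
        using preds_of_completed completed_mono_alg[of "t - 1 - 1" "t - 1"] by fastforce
      with j c show False by (auto simp: mem_succ_closed_iff front_def)
    qed
    with j show "u \<in> unfinished t"
      using front_subset_jobs succ_closed_subset_jobs by (auto simp: unfinished_def)
  qed
qed

text \<open>A common descendant would make \<open>i\<close> and \<open>j\<close> comparable, but a
  front job is not completed while all its predecessors are.\<close>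

lemma succ_closed_front_disjoint:
  assumes "i \<in> front I R t" "j \<in> front I R t" "i \<noteq> j"
  shows "succ_closed I i \<inter> succ_closed I j = {}"
proof (rule ccontr)
  assume "succ_closed I i \<inter> succ_closed I j \<noteq> {}"
  then have "(i, j) \<in> (edges I)\<^sup>* \<or> (j, i) \<in> (edges I)\<^sup>*"
    using ancestors_comparable by (auto simp: succ_closed_def)
  then have "i \<in> preds I j \<or> j \<in> preds I i"
    using assms(3) by (auto simp: preds_def rtrancl_eq_or_trancl)
  with assms show False by (auto simp: front_def)
qed

text \<open>Identifies the denominator of the rates with the unfinished weight
  \<open>W\<close>.\<close>

lemma sum_subtree_weight_front:
  "(\<Sum>j\<in>front I R t. subtree_weight I j) = (\<Sum>u\<in>unfinished t. weight I u)"
  unfolding unfinished_eq_Union subtree_weight_def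
proof (rule sum.UNION_disjoint[symmetric])
  show "\<forall>i\<in>front I R t. finite (succ_closed I i)"
    using finite_succ_closed front_subset_jobs by blast
qed (auto simp: finite_front succ_closed_front_disjoint)

text \<open>As \<open>P\<close> passes to predecessors, the front job above an unfinished
  \<open>u\<close> with \<open>P u\<close> inherits \<open>P\<close>, and its subtree covers
  \<open>u\<close>. Later \<open>P\<close> is completion in the comparison schedule by a given
  time.\<close>

lemma weight_behind_le_front:
  assumes anc: "\<And>i u. i \<in> preds I u \<Longrightarrow> P u \<Longrightarrow> P i"
  shows "(\<Sum>u\<in>{u \<in> unfinished t. P u}. weight I u)
    \<le> (\<Sum>j\<in>{j \<in> front I R t. P j}. subtree_weight I j)"
proof -
  let ?F = "{j \<in> front I R t. P j}"
  have "(\<Sum>u\<in>{u \<in> unfinished t. P u}. weight I u) \<le> (\<Sum>u\<in>(\<Union>j\<in>?F. succ_closed I j). weight I u)"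
  proof (rule sum_mono2)
    show "finite (\<Union>j\<in>?F. succ_closed I j)"
      using finite_front finite_succ_closed front_subset_jobs by (intro finite_UN_I) auto
    show "{u \<in> unfinished t. P u} \<subseteq> (\<Union>j\<in>?F. succ_closed I j)"
      using anc by (auto simp: unfinished_eq_Union mem_succ_closed_iff)
    show "0 \<le> weight I u" if "u \<in> (\<Union>j\<in>?F. succ_closed I j) - {u \<in> unfinished t. P u}" for u
      using that front_subset_jobs succ_closed_subset_jobs weight_nonneg by blast
  qed
  also have "\<dots> = (\<Sum>j\<in>?F. subtree_weight I j)"
    unfolding subtree_weight_def
  proof (rule sum.UNION_disjoint)
    show "\<forall>i\<in>?F. finite (succ_closed I i)"
      using finite_succ_closed front_subset_jobs by blast
    show "\<forall>i\<in>?F. \<forall>j\<in>?F. i \<noteq> j \<longrightarrow> succ_closed I i \<inter> succ_closed I j = {}"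
      using succ_closed_front_disjoint by blast
  qed (simp add: finite_front)
  finally show ?thesis .
qed

section \<open>Rate volume, termination and feasibility\<close>

text \<open>At the last step \<open>m\<close> of \<open>A\<close> the job has no open predecessors
  and yet is not completed, so even its total rate through \<open>m\<close> is below its
  size.\<close>

lemma sum_rate_before_completion:
  assumes j: "j \<in> jobs I" and A: "A = {s \<in> {1..T}. j \<in> front I R s \<and> j \<notin> completed I R s}"
  shows "(\<Sum>s\<in>A. R s j) \<le> proc I j"
proof (cases "A = {}")
  case False
  have finA: "finite A" by (simp add: A)
  define m where "m = Max A"
  have mA: "m \<in> A" using finA False by (simp add: m_def)
  then obtain n where n: "m = Suc n" by (cases m) (auto simp: A)
  have "(\<Sum>s\<in>A. R s j) \<le> (\<Sum>s=1..m. R s j)"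
    using finA rate_nonneg by (intro sum_mono2) (auto simp: m_def A)
  also have "\<dots> \<le> proc I j"
    using mA j unfolding n by (auto simp: A front_def)
  finally show ?thesis .
qed (use proc_nonneg[OF j] in simp)

lemma completed_once:
  assumes "j \<in> front I R s" "j \<in> completed I R s" "j \<in> front I R t" "j \<in> completed I R t"
  shows "s = t"
proof -
  have "\<not> a < b" if "j \<in> completed I R a" "j \<in> front I R b" for a b
  proof
    assume "a < b"
    then have "completed I R a \<subseteq> completed I R (b - 1)"
      by (intro completed_mono_alg) auto
    with that show False by (auto simp: front_def)
  qed
  with assms show ?thesis by (meson linorder_neqE_nat)
qed

text \<open>A job leaves the front on completion, so each \<open>f j\<close> is charged in at most
  one step.\<close>

lemma sum_completing_le:
  assumes "\<And>j. j \<in> jobs I \<Longrightarrow> 0 \<le> f j"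
  shows "(\<Sum>s=1..T. \<Sum>j\<in>{j \<in> front I R s. j \<in> completed I R s}. f j)
    \<le> (\<Sum>j\<in>jobs I. f j :: real)"
proof -
  have "(\<Sum>s=1..T. \<Sum>j\<in>{j \<in> front I R s. j \<in> completed I R s}. f j)
      = (\<Sum>j\<in>(\<Union>s\<in>{1..T}. {j \<in> front I R s. j \<in> completed I R s}). f j)"
    using finite_front completed_once by (intro sum.UNION_disjoint[symmetric]) auto
  also have "\<dots> \<le> (\<Sum>j\<in>jobs I. f j)"
    using assms finite_jobs front_subset_jobs by (intro sum_mono2) auto
  finally show ?thesis .
qed

lemma sum_split_completing:
  "(\<Sum>j\<in>{j \<in> front I R s. P j}. f j)
    = (\<Sum>j\<in>{j \<in> front I R s. j \<notin> completed I R s \<and> P j}. f j)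
    + (\<Sum>j\<in>{j \<in> front I R s. j \<in> completed I R s \<and> P j}. f j :: real)"
proof -
  have "{j \<in> front I R s. P j} = {j \<in> front I R s. j \<notin> completed I R s \<and> P j}
      \<union> {j \<in> front I R s. j \<in> completed I R s \<and> P j}"
    by blast
  then show ?thesis
    using finite_front[of s] by (simp only:) (rule sum.union_disjoint, auto)
qed

lemma sum_not_completing_le:
  assumes "K \<subseteq> jobs I"
  shows "(\<Sum>s=1..T. \<Sum>j\<in>{j \<in> front I R s. j \<notin> completed I R s \<and> j \<in> K}. R s j)
    \<le> (\<Sum>j\<in>K. proc I j)"
proof -
  have finK: "finite K" using assms finite_jobs finite_subset by blast
  have "(\<Sum>s=1..T. \<Sum>j\<in>{j \<in> front I R s. j \<notin> completed I R s \<and> j \<in> K}. R s j)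
      = (\<Sum>s=1..T. \<Sum>j\<in>{j \<in> K. j \<in> front I R s \<and> j \<notin> completed I R s}. R s j)"
    by (intro sum.cong refl) auto
  also have "\<dots> = (\<Sum>j\<in>K. \<Sum>s\<in>{s \<in> {1..T}. j \<in> front I R s \<and> j \<notin> completed I R s}. R s j)"
    by (rule sum.swap_restrict) (use finK in auto)
  also have "\<dots> \<le> (\<Sum>j\<in>K. proc I j)"
    using assms by (intro sum_mono sum_rate_before_completion) auto
  finally show ?thesis .
qed

text \<open>Each step in which something is left to do either spends its whole unit of rate on jobs that
  stay unfinished, or completes a job.\<close>

lemma eventually_all_completed: "\<exists>T. jobs I \<subseteq> completed I R T"
proof (rule ccontr)
  assume neg: "\<not> ?thesis"
  \<comment> \<open>The total size bounds the rate spent on jobs that stay unfinished, and the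
    number of jobs bounds the completions, so \<open>T\<close> busy steps are too many.\<close>
  obtain T :: nat where T: "(\<Sum>j\<in>jobs I. proc I j) + real (card (jobs I)) < real T"
    using reals_Archimedean2 by blast
  have "real T = (\<Sum>s=1..T. 1)" by simp
  also have "\<dots> \<le> (\<Sum>s=1..T. (\<Sum>j\<in>{j \<in> front I R s. j \<notin> completed I R s \<and> j \<in> jobs I}. R s j)
      + (\<Sum>j\<in>{j \<in> front I R s. j \<in> completed I R s}. 1))"
  proof (rule sum_mono)
    fix s assume s: "s \<in> {1..T}"
    have "unfinished s \<noteq> {}" using neg by (auto simp: unfinished_def)
    then have ne: "front I R s \<noteq> {}" by (auto simp: unfinished_eq_Union)
    have le1: "R s j \<le> 1" if "j \<in> front I R s" for j
      using member_le_sum[OF that, of "R s"] rate_nonneg s finite_front sum_rate_front[OF _ ne]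
      by auto
    have "{j \<in> front I R s. j \<in> jobs I} = front I R s"
      using front_subset_jobs by auto
    then have "1 = (\<Sum>j\<in>{j \<in> front I R s. j \<in> jobs I}. R s j)"
      using sum_rate_front[OF _ ne] s by simp
    also have "\<dots> = (\<Sum>j\<in>{j \<in> front I R s. j \<notin> completed I R s \<and> j \<in> jobs I}. R s j)
        + (\<Sum>j\<in>{j \<in> front I R s. j \<in> completed I R s \<and> j \<in> jobs I}. R s j)"
      by (rule sum_split_completing)
    also have "{j \<in> front I R s. j \<in> completed I R s \<and> j \<in> jobs I}
        = {j \<in> front I R s. j \<in> completed I R s}"
      using front_subset_jobs by auto
    also have "(\<Sum>j\<in>{j \<in> front I R s. j \<in> completed I R s}. R s j)
        \<le> (\<Sum>j\<in>{j \<in> front I R s. j \<in> completed I R s}. 1)"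
      using le1 by (intro sum_mono) auto
    finally show "1 \<le> (\<Sum>j\<in>{j \<in> front I R s. j \<notin> completed I R s \<and> j \<in> jobs I}. R s j)
        + (\<Sum>j\<in>{j \<in> front I R s. j \<in> completed I R s}. 1)" by simp
  qed
  also have "\<dots> \<le> (\<Sum>j\<in>jobs I. proc I j) + (\<Sum>j\<in>jobs I. 1)"
    unfolding sum.distrib
    by (intro add_mono sum_not_completing_le sum_completing_le) auto
  finally show False using T by simp
qed

lemma feasible: "feasible I R"
  unfolding feasible_def
proof (intro conjI allI impI ballI)
  fix t :: nat and j assume t: "1 \<le> t"
  show "0 \<le> R t j" using t by (rule rate_nonneg)
  have "(\<Sum>j\<in>jobs I. R t j) = (\<Sum>j\<in>front I R t. R t j)"
    using finite_jobs front_subset_jobs t by (intro sum.mono_neutral_right) (auto simp: rate)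
  then show "(\<Sum>j\<in>jobs I. R t j) \<le> 1"
    using sum_rate_front[OF t] by (cases "front I R t = {}") auto
  assume "0 < R t j"
  then have "j \<in> front I R t" using rate[OF t, of j] by (auto split: if_splits)
  then show "j \<in> jobs I" "preds I j \<subseteq> completed I R (t - 1)"
    by (auto simp: front_def)
next
  fix j assume "j \<in> jobs I"
  then show "\<exists>t. j \<in> completed I R t" using eventually_all_completed by blast
qed

section \<open>Comparison with an arbitrary feasible schedule\<close>

text \<open>A job with completion time \<open>C\<close> is unfinished at the start of exactly the
  steps \<open>1, ..., C\<close>, so its weight is counted \<open>C\<close> times.\<close>

lemma cost_eq_sum_unfinished:
  assumes T: "jobs I \<subseteq> completed I R T"
  shows "cost I R = (\<Sum>s=1..T. \<Sum>u\<in>unfinished s. weight I u)"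
proof -
  have "(\<Sum>s=1..T. \<Sum>u\<in>unfinished s. weight I u)
      = (\<Sum>s=1..T. \<Sum>u\<in>{u \<in> jobs I. u \<notin> completed I R (s - 1)}. weight I u)"
    by (intro sum.cong) (auto simp: unfinished_def)
  also have "\<dots> = (\<Sum>u\<in>jobs I. \<Sum>s\<in>{s \<in> {1..T}. u \<notin> completed I R (s - 1)}. weight I u)"
    by (rule sum.swap_restrict) (use finite_jobs in auto)
  also have "\<dots> = cost I R"
    unfolding cost_def
  proof (rule sum.cong[OF refl])
    fix u assume u: "u \<in> jobs I"
    have iff: "u \<in> completed I R t \<longleftrightarrow> completion_time I R u \<le> t" for t
      using T u by (intro completed_iff_completion_time_le rate_nonneg) auto
    have "completion_time I R u \<le> T" using iff T u by blast
    then have "{s \<in> {1..T}. u \<notin> completed I R (s - 1)} = {1..completion_time I R u}"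
      by (auto simp: iff)
    then show "(\<Sum>s\<in>{s \<in> {1..T}. u \<notin> completed I R (s - 1)}. weight I u)
        = weight I u * real (completion_time I R u)"
      by simp
  qed
  finally show ?thesis by simp
qed

text \<open>The inequality for a single step. A completing job may get more rate than its remaining
  size, so volume does not bound that rate; its whole subtree weight is charged instead, which
  happens only once per job.\<close>

lemma unfinished_weight_le:
  assumes Q: "feasible I Q" and s: "1 \<le> s"
  shows "(\<Sum>u\<in>unfinished s. weight I u) \<le> 2 *
    ((\<Sum>u\<in>jobs I. weight I u *
        (\<Sum>j\<in>{j \<in> front I R s. j \<notin> completed I R s \<and>
                 j \<in> completed I Q (completion_time I Q u)}. R s j))
     + (\<Sum>j\<in>{j \<in> front I R s. j \<in> completed I R s}. subtree_weight I j))"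
proof -
  let ?c = "completion_time I Q" and ?w = "weight I" and ?U = "unfinished s"
  let ?N = "\<lambda>u. \<Sum>j\<in>{j \<in> front I R s. j \<notin> completed I R s \<and> j \<in> completed I Q (?c u)}. R s j"
  define W where "W = (\<Sum>u\<in>?U. ?w u)"
  define D where "D = (\<Sum>j\<in>{j \<in> front I R s. j \<in> completed I R s}. subtree_weight I j)"
  have UJ: "?U \<subseteq> jobs I" by (auto simp: unfinished_def)
  have wU: "0 \<le> ?w u" if "u \<in> ?U" for u using that UJ weight_nonneg by blast
  have W0: "0 \<le> W" unfolding W_def using wU by (rule sum_nonneg)
  have D0: "0 \<le> D" unfolding D_def
    using front_subset_jobs subtree_weight_nonneg by (intro sum_nonneg) auto
  have N0: "0 \<le> ?N u" for u using rate_nonneg s by (intro sum_nonneg) auto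
  have nonneg: "0 \<le> Q t j" if "1 \<le> t" for t j
    using Q that by (auto simp: feasible_def)
  have iff: "j \<in> completed I Q t \<longleftrightarrow> ?c j \<le> t" if "j \<in> jobs I" for j t
    using Q that by (intro completed_iff_completion_time_le nonneg) (auto simp: feasible_def)
  have N_le: "(\<Sum>u\<in>?U. ?w u * ?N u) \<le> (\<Sum>u\<in>jobs I. ?w u * ?N u)"
    by (rule sum_mono2[OF finite_jobs UJ]) (simp add: N0 weight_nonneg)
  show ?thesis
  proof (cases "W = 0")
    case True
    have "0 \<le> (\<Sum>u\<in>jobs I. ?w u * ?N u)"
      by (rule sum_nonneg) (simp add: N0 weight_nonneg)
    then show ?thesis using True D0 by (simp add: W_def D_def)
  next
    case False
    with W0 have W: "0 < W" by simp
    have rate': "W * R s j = subtree_weight I j" if "j \<in> front I R s" for j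
      using that False s by (simp add: rate sum_subtree_weight_front W_def)
    have behind: "(\<Sum>k\<in>{k \<in> ?U. ?c k \<le> ?c u}. ?w k) \<le> W * ?N u + D" for u
    proof -
      \<comment> \<open>Written as membership in \<open>completed I Q\<close>, the condition is
        inherited by predecessors, as \<open>weight_behind_le_front\<close> requires.\<close>
      have "{k \<in> ?U. ?c k \<le> ?c u} = {k \<in> ?U. k \<in> completed I Q (?c u)}"
        using iff UJ by blast
      then have "(\<Sum>k\<in>{k \<in> ?U. ?c k \<le> ?c u}. ?w k)
          \<le> (\<Sum>j\<in>{j \<in> front I R s. j \<in> completed I Q (?c u)}. subtree_weight I j)"
        using preds_of_completed[of _ I Q "?c u"] completed_mono[of Q "?c u - 1" "?c u", OF nonneg]
        by (simp only:) (intro weight_behind_le_front, force)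
      also have "\<dots> = (\<Sum>j\<in>{j \<in> front I R s. j \<notin> completed I R s \<and> j \<in> completed I Q (?c u)}.
            subtree_weight I j)
          + (\<Sum>j\<in>{j \<in> front I R s. j \<in> completed I R s \<and> j \<in> completed I Q (?c u)}.
            subtree_weight I j)"
        by (rule sum_split_completing)
      \<comment> \<open>The rate rule turns the first sum into \<open>W * ?N u\<close>; dropping the
        condition on \<open>Q\<close> in the second leaves \<open>D\<close>, a bound independent of
        \<open>u\<close>.\<close>
      also have "\<dots> \<le> W * ?N u + D"
        unfolding D_def sum_distrib_left
        using finite_front front_subset_jobs subtree_weight_nonneg
        by (intro add_mono sum_mono2) (auto simp: rate' intro!: sum_mono)
      finally show ?thesis .
    qed
    have "W\<^sup>2 \<le> 2 * (\<Sum>u\<in>?U. ?w u * (\<Sum>k\<in>{k \<in> ?U. ?c k \<le> ?c u}. ?w k))"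
      unfolding W_def by (rule sum_square_le_twice_ordered[OF finite_unfinished wU])
    also have "\<dots> \<le> 2 * (\<Sum>u\<in>?U. ?w u * (W * ?N u + D))"
      using behind wU by (intro mult_left_mono sum_mono) auto
    \<comment> \<open>\<open>D\<close> is free of \<open>u\<close>, so its weighted sum is
      \<open>W * D\<close>, and one factor \<open>W\<close> cancels below.\<close>
    also have "(\<Sum>u\<in>?U. ?w u * (W * ?N u + D)) = W * ((\<Sum>u\<in>?U. ?w u * ?N u) + D)"
      by (simp add: W_def algebra_simps sum.distrib sum_distrib_left)
    finally have "W * W \<le> W * (2 * ((\<Sum>u\<in>?U. ?w u * ?N u) + D))"
      by (simp add: power2_eq_square algebra_simps)
    then have "W \<le> 2 * ((\<Sum>u\<in>?U. ?w u * ?N u) + D)"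
      using W by (simp only: mult_le_cancel_left_pos)
    also have "\<dots> \<le> 2 * ((\<Sum>u\<in>jobs I. ?w u * ?N u) + D)"
      using N_le by (intro mult_left_mono add_right_mono) auto
    finally show ?thesis unfolding W_def D_def .
  qed
qed

text \<open>The two sums over all steps are each at most \<open>cost I Q\<close>, which with the
  factor 2 per step gives 4.\<close>

lemma cost_le:
  assumes Q: "feasible I Q"
  shows "cost I R \<le> 4 * cost I Q"
proof -
  obtain T where T: "jobs I \<subseteq> completed I R T" using eventually_all_completed by blast
  let ?K = "\<lambda>u. completed I Q (completion_time I Q u)"
  let ?N = "\<lambda>s u. \<Sum>j\<in>{j \<in> front I R s. j \<notin> completed I R s \<and> j \<in> ?K u}. R s j"
  let ?D = "\<lambda>s. \<Sum>j\<in>{j \<in> front I R s. j \<in> completed I R s}. subtree_weight I j"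
  have "cost I R \<le> (\<Sum>s=1..T. 2 * ((\<Sum>u\<in>jobs I. weight I u * ?N s u) + ?D s))"
    unfolding cost_eq_sum_unfinished[OF T]
    by (intro sum_mono unfinished_weight_le Q) auto
  also have "\<dots> = 2 * ((\<Sum>s=1..T. \<Sum>u\<in>jobs I. weight I u * ?N s u) + (\<Sum>s=1..T. ?D s))"
    by (simp only: sum_distrib_left[symmetric] sum.distrib)
  also have "(\<Sum>s=1..T. \<Sum>u\<in>jobs I. weight I u * ?N s u)
      = (\<Sum>u\<in>jobs I. weight I u * (\<Sum>s=1..T. ?N s u))"
    by (subst sum.swap) (simp only: sum_distrib_left)
  also have "\<dots> \<le> cost I Q"
    unfolding cost_def
  proof (intro sum_mono mult_left_mono weight_nonneg)
    fix u
    \<comment> \<open>\<open>?K u\<close> is what \<open>Q\<close> has completed by the time it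
      completes \<open>u\<close>, so its volume fits into that time.\<close>
    have "(\<Sum>s=1..T. ?N s u) \<le> (\<Sum>j\<in>?K u. proc I j)"
      by (rule sum_not_completing_le[OF completed_subset_jobs])
    also have "\<dots> \<le> real (completion_time I Q u)"
      by (rule volume_le_time[OF Q finite_jobs order_refl])
    finally show "(\<Sum>s=1..T. ?N s u) \<le> real (completion_time I Q u)" .
  qed
  also have "(\<Sum>s=1..T. ?D s) \<le> (\<Sum>j\<in>jobs I. subtree_weight I j)"
    by (rule sum_completing_le[OF subtree_weight_nonneg])
  also have "\<dots> \<le> cost I Q"
    by (rule sum_subtree_weight_le_cost[OF Q])
  finally show ?thesis by simp
qed

end

section \<open>The online algorithm and its competitive ratio\<close>

text \<open>Memoryless: only the last observation enters. Its domain is the front, and the second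
  component of an entry is the prediction.\<close>

definition proportional_algorithm :: "'a online_algorithm" where
  "proportional_algorithm h j =
    (let obs = last h; F = dom obs; pred = (\<lambda>k. snd (the (obs k)))
     in if j \<in> F
        then if (\<Sum>k\<in>F. pred k) = 0 then 1 / real (card F) else pred j / (\<Sum>k\<in>F. pred k)
        else 0)"

lemma proportional_schedule_alg_schedule:
  assumes "out_forest_instance I" "correct_predictions I What"
  shows "proportional_schedule I (alg_schedule proportional_algorithm I What)"
proof
  show "out_forest_instance I" by fact
next
  fix t :: nat and j
  assume t: "1 \<le> t"
  let ?R = "alg_schedule proportional_algorithm I What"
  have "?R t = proportional_algorithm (map (observe I What ?R) [1..<Suc t])"
    by (rule alg_schedule_step[OF t])
  moreover have "last (map (observe I What ?R) [1..<Suc t]) = observe I What ?R t"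
    using t by simp
  moreover have "dom (observe I What ?R t) = front I ?R t"
    by (auto simp: observe_def split: if_splits)
  moreover have "snd (the (observe I What ?R t k)) = subtree_weight I k" if "k \<in> front I ?R t" for k
    using that assms(2)
    by (auto simp: observe_def correct_predictions_def subtree_weight_def front_def)
  ultimately show "?R t j =
    (if j \<in> front I ?R t
     then if (\<Sum>k\<in>front I ?R t. subtree_weight I k) = 0 then 1 / real (card (front I ?R t))
          else subtree_weight I j / (\<Sum>k\<in>front I ?R t. subtree_weight I k)
     else 0)"
    by (simp add: proportional_algorithm_def cong: sum.cong)
qed

theorem theorem6:
  "\<exists>A :: 'a online_algorithm. competitive_given_correct_predictions 4 A"
proof -
  have "competitive_given_correct_predictions 4 (proportional_algorithm :: 'a online_algorithm)"
    unfolding competitive_given_correct_predictions_def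
  proof (intro allI impI, elim conjE)
    fix I :: "'a sched_instance" and What
    assume "out_forest_instance I" "correct_predictions I What"
    then interpret proportional_schedule I "alg_schedule proportional_algorithm I What"
      by (rule proportional_schedule_alg_schedule)
    let ?R = "alg_schedule proportional_algorithm I What"
    \<comment> \<open>\<open>Opt\<close> is an infimum, so the bound is shown against every feasible
      schedule; the algorithm's own schedule witnesses that there is one.\<close>
    have "cost I ?R / 4 \<le> Opt I"
      unfolding Opt_def
    proof (rule cInf_greatest)
      show "cost I ` {R. feasible I R} \<noteq> {}" using feasible by blast
      show "cost I ?R / 4 \<le> x" if "x \<in> cost I ` {R. feasible I R}" for x
        using that cost_le by (auto simp: mult.commute)
    qed
    with feasible show "feasible I ?R \<and> cost I ?R \<le> 4 * Opt I" by simp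
  qed
  then show ?thesis by blast
qed

end
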